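(* Let $\mathcal{T}$ be an RGBK-tournament. The following are equivalent. (1) $\mathcal{T}$ is canonical, i.e. fixed under $\operatorname{Color}\circ\operatorname{Record}$ and $\operatorname{Dual}\circ\operatorname{Color}\circ\operatorname{Record}\circ\operatorname{Dual}$. (2) $\mathcal{T}$ is geometric, and for each color class $C\in\{RGK,RBK,GBK\}$: the $C$-stratification of $\mathcal{T}$ is geometric; the $C$-minimal vertices form an increasing $C$-colored path, as do the $C$-maximal vertices; and the dual $C$-strata are the usual $C$-strata in reverse (i.e. if $V_1,\dots,V_m$ are the $C$-strata, then the dual $C$-strata are $V_m,\dots,V_1$ in this order). (3) $\mathcal{T}=\operatorname{Color}(S)$ for some ordered set $S$ such that $S$ and $(1+\ell(RGK),1+\ell(RBK),1+\ell(GBK))-S$ are both reduced sets of triples belonging to $\mathbb{Z}_{>0}^3$. Furthermore, if $\mathcal{T}$ satisfies any of these equivalent conditions, then the only $S$ that works in (3) is $S=\operatorname{Record}(\mathcal{T})$.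
   Context: An *RGBK-tournament* is a transitive tournament on ordered vertices $v_1<\dots<v_N$ with each edge $v_i\to v_j$ ($i<j$) colored one of four colors $R,G,B,K$. A *color class* is a set of colors, written as a string (e.g. $RGK=\{R,G,K\}$); an edge is $C$-colored if its color lies in $C$. $\ell(C)=\ell_{\mathcal{T}}(C)$ is the maximum number of vertices of a $C$-colored directed path in $\mathcal{T}$ (length always counts vertices; a single vertex is a path). A finite set $S\subseteq\mathbb{R}^3$ is *ordered* if it can be listed as $L_1,\dots,L_{|S|}$ such that for all $i<j$ the difference $L_j-L_i$ has at least two strictly positive coordinates. $\operatorname{Record}(\mathcal{T})\subseteq\mathbb{Z}_{>0}^3$ is the ordered set whose triples, listed in the order of the vertices, are $(x_v,y_v,z_v)$, where $x_v,y_v,z_v$ are the lengths of the longest $RGK$-, $RBK$-, $GBK$-colored directed paths ending at $v$. For an ordered set $S$ with listing $L_1,\dots,L_{|S|}$, $\operatorname{Color}(S)$ is the RGBK-tournament on $v_1,\dots,v_{|S|}$ in which, for $i<j$, $v_i\to v_j$ is colored according to $L_j-L_i$: $R$ if $(+,+,\le 0)$, $G$ if $(+,\le 0,+)$, $B$ if $(\le 0,+,+)$, $K$ if $(+,+,+)$, where $+$ means strictly positive. $\operatorname{Dual}(\mathcal{T})$ is obtained by reversing all edge directions (hence the vertex order) and keeping edge colors. An RGBK-tournament is *geometric* if it equals $\operatorname{Color}(S)$ for some ordered set $S\subseteq\mathbb{R}^3$. The *$C$-stratification* of $\mathcal{T}$ is the vertex-partition $V_1\sqcup\dots\sqcup V_m$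 into *$C$-strata*, where $v\in V_\ell$ iff the longest $C$-colored path ending at $v$ has length $\ell$ (so $m=\ell(C)$). For $C\in\{RGK,RBK,GBK\}$, it is *geometric* if for all $u\in V_i$, $v\in V_j$ with $u<v$, the edge $u\to v$ is $C$-colored if and only if $i<j$. The *$C$-minimal vertices* are $v^0_1,\dots,v^0_m$, where $v^0_i$ is the smallest vertex of $V_i$; they form an increasing $C$-colored path if $v^0_1<v^0_2<\dots<v^0_m$ and the edges $v^0_i\to v^0_{i+1}$ are $C$-colored. The *dual $C$-strata* and *$C$-maximal vertices* of $\mathcal{T}$ are the sets and vertices of $\mathcal{T}$ corresponding under $\operatorname{Dual}$ to the $C$-strata and $C$-minimal vertices of $\operatorname{Dual}(\mathcal{T})$, respectively (so the $i$-th dual stratum consists of the vertices $v$ for which the longest $C$-colored path of $\mathcal{T}$ starting at $v$ has length $i$, and the $i$-th $C$-maximal vertex is the largest vertex of the $i$-th dual stratum). A *reduced set* is an ordered set $S\subseteq\mathbb{Z}_{>0}^3$ such that for each coordinate $c\in\{x,y,z\}$ and each $\mathbf{p}\in S$ with $c$-coordinate $i\ge 2$, there exists $\mathbf{q}\in S$ with $c$-coordinate exactly $i-1$ such that $\mathbf{p}-\mathbf{q}$ has at least two positive coordinates. For a vector $\mathbf{a}$, $\mathbf{a}-S=\{\mathbf{a}-\mathbf{s}:\mathbf{s}\in S\}$. *)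

theory Defs
  imports "HOL-Analysis.Analysis"
begin

section \<open>RGBK-tournaments\<close>

datatype color = Red | Green | Blue | Black

abbreviation RGK :: "color set" where "RGK \<equiv> {Red, Green, Black}"
abbreviation RBK :: "color set" where "RBK \<equiv> {Red, Blue, Black}"
abbreviation GBK :: "color set" where "GBK \<equiv> {Green, Blue, Black}"

text \<open>
  The vertices are \<open>0 < 1 < \<dots> < nverts T - 1\<close>, and \<open>ecol T i j\<close> is \<open>None\<close> exactly when there is
  no edge \<open>i \<rightarrow> j\<close>.  With this convention equality of tournaments is HOL equality.
\<close>

record rgbk =
  nverts :: nat
  ecol :: "nat \<Rightarrow> nat \<Rightarrow> color option"

definition tournament :: "rgbk \<Rightarrow> bool" where
  "tournament T \<longleftrightarrow> (\<forall>i j. ecol T i j \<noteq> None \<longleftrightarrow> i < j \<and> j < nverts T)"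

definition C_edge :: "rgbk \<Rightarrow> color set \<Rightarrow> nat \<Rightarrow> nat \<Rightarrow> bool" where
  "C_edge T C u v \<longleftrightarrow> (\<exists>c\<in>C. ecol T u v = Some c)"

text \<open>
  A path is the list of its vertices.  The empty list is admitted so that \<open>ell\<close> below is \<open>0\<close>
  for the tournament without vertices.
\<close>

definition C_path :: "rgbk \<Rightarrow> color set \<Rightarrow> nat list \<Rightarrow> bool" where
  "C_path T C p \<longleftrightarrow> set p \<subseteq> {..<nverts T} \<and>
     (\<forall>i. Suc i < length p \<longrightarrow> C_edge T C (p ! i) (p ! Suc i))"

definition ell :: "rgbk \<Rightarrow> color set \<Rightarrow> nat" where
  "ell T C = Max {length p |p. C_path T C p}"

definition ell_at :: "rgbk \<Rightarrow> color set \<Rightarrow> nat \<Rightarrow> nat" where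
  "ell_at T C v = Max {length p |p. C_path T C p \<and> p \<noteq> [] \<and> last p = v}"

definition Dual :: "rgbk \<Rightarrow> rgbk" where
  "Dual T = \<lparr>nverts = nverts T,
     ecol = (\<lambda>i j. if i < j \<and> j < nverts T
                   then ecol T (nverts T - 1 - j) (nverts T - 1 - i) else None)\<rparr>"

section \<open>Ordered sets\<close>

definition two_pos :: "real ^ 3 \<Rightarrow> bool" where
  "two_pos d \<longleftrightarrow> 2 \<le> card {c. 0 < d $ c}"

definition is_listing :: "(real ^ 3) set \<Rightarrow> (real ^ 3) list \<Rightarrow> bool" where
  "is_listing S L \<longleftrightarrow> set L = S \<and> length L = card S \<and>
     (\<forall>i j. i < j \<and> j < length L \<longrightarrow> two_pos (L ! j - L ! i))"

definition ordered :: "(real ^ 3) set \<Rightarrow> bool" where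
  "ordered S \<longleftrightarrow> finite S \<and> (\<exists>L. is_listing S L)"

lemma two_pos_asym: "two_pos d \<Longrightarrow> \<not> two_pos (- d)"
proof
  assume a: "two_pos d" "two_pos (- d)"
  let ?A = "{c. 0 < d $ c}" and ?B = "{c. 0 < (- d) $ c}"
  have "card (?A \<union> ?B) = card ?A + card ?B"
    by (rule card_Un_disjoint) auto
  moreover have "card (?A \<union> ?B) \<le> card (UNIV :: 3 set)"
    by (rule card_mono) auto
  ultimately show False using a by (simp add: two_pos_def)
qed

lemma is_listing_unique:
  assumes "is_listing S L" "is_listing S L'"
  shows "L = L'"
proof -
  define r where "r = (\<lambda>p q :: real ^ 3. two_pos (q - p))"
  have asym: "\<not> r q p" if "r p q" for p q
    using two_pos_asym[of "q - p"] that by (simp add: r_def)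
  have *: "sorted_wrt r M" "distinct M" "set M = S" if "is_listing S M" for M
    using that by (auto simp: is_listing_def r_def sorted_wrt_iff_nth_less card_distinct)
  have "M = M'" if "sorted_wrt r M" "sorted_wrt r M'" "distinct M" "distinct M'" "set M = set M'"
    for M M'
    using that
  proof (induction M arbitrary: M')
    case (Cons a M)
    then obtain b N where M': "M' = b # N" by (cases M') auto
    have "a = b"
    proof (rule ccontr)
      assume "a \<noteq> b"
      with Cons.prems M' have "a \<in> set N" "b \<in> set M" by auto
      with Cons.prems M' asym show False by auto
    qed
    with Cons.prems M' have "set M = set N" by auto
    with Cons M' \<open>a = b\<close> show ?case by auto
  qed auto
  with *[OF assms(1)] *[OF assms(2)] show ?thesis by blast
qed

definition listing :: "(real ^ 3) set \<Rightarrow> (real ^ 3) list" where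
  "listing S = (THE L. is_listing S L)"

lemma listing_eq: "is_listing S L \<Longrightarrow> listing S = L"
  unfolding listing_def using is_listing_unique by blast

text \<open>
  Only used for differences with at least two positive coordinates, where the last case is
  \<open>(+, +, +)\<close>.
\<close>

definition color_of :: "real ^ 3 \<Rightarrow> color" where
  "color_of d =
     (if 0 < d $ 1 \<and> 0 < d $ 2 \<and> d $ 3 \<le> 0 then Red
      else if 0 < d $ 1 \<and> d $ 2 \<le> 0 \<and> 0 < d $ 3 then Green
      else if d $ 1 \<le> 0 \<and> 0 < d $ 2 \<and> 0 < d $ 3 then Blue
      else Black)"

definition Color :: "(real ^ 3) set \<Rightarrow> rgbk" where
  "Color S = \<lparr>nverts = card S,
     ecol = (\<lambda>i j. if i < j \<and> j < card S
                   then Some (color_of (listing S ! j - listing S ! i)) else None)\<rparr>"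

definition record_triple :: "rgbk \<Rightarrow> nat \<Rightarrow> real ^ 3" where
  "record_triple T v =
     vector [real (ell_at T RGK v), real (ell_at T RBK v), real (ell_at T GBK v)]"

definition Record :: "rgbk \<Rightarrow> (real ^ 3) set" where
  "Record T = record_triple T ` {..<nverts T}"

lemma C_edgeD:
  assumes "tournament T" "C_edge T C u v"
  shows "u < v" "v < nverts T"
proof -
  have "ecol T u v \<noteq> None" using assms(2) by (auto simp: C_edge_def)
  with assms(1) show "u < v" "v < nverts T" by (simp_all add: tournament_def)
qed

lemma finite_path_lengths:
  assumes "tournament T"
  shows "finite {length p |p. C_path T C p \<and> P p}"
proof -
  have "length p \<le> nverts T" if "C_path T C p" for p
  proof -
    have "\<forall>i. Suc i < length p \<longrightarrow> p ! i < p ! Suc i"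
      using that C_edgeD(1)[OF assms] by (auto simp: C_path_def)
    then have "sorted_wrt (<) p"
      by (simp add: sorted_wrt_iff_nth_Suc_transp)
    then have "distinct p" by (simp add: strict_sorted_iff)
    then have "length p = card (set p)" by (simp add: distinct_card)
    also have "\<dots> \<le> card {..<nverts T}"
      using that by (intro card_mono) (auto simp: C_path_def)
    finally show ?thesis by simp
  qed
  then have "{length p |p. C_path T C p \<and> P p} \<subseteq> {..nverts T}" by auto
  then show ?thesis by (rule finite_subset) simp
qed

lemma ell_at_less:
  assumes T: "tournament T" and e: "C_edge T C u v"
  shows "ell_at T C u < ell_at T C v"
proof -
  have uv: "u < nverts T" "v < nverts T"
    using C_edgeD[OF T e] by auto
  let ?A = "\<lambda>w. {length p |p. C_path T C p \<and> p \<noteq> [] \<and> last p = w}"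
  have fin: "finite (?A w)" for w by (rule finite_path_lengths[OF T])
  have "1 \<in> ?A u" using uv by (intro CollectI exI[of _ "[u]"]) (auto simp: C_path_def)
  then have "Max (?A u) \<in> ?A u" using fin by (intro Max_in) auto
  then obtain p where p: "C_path T C p" "p \<noteq> []" "last p = u" "length p = Max (?A u)" by auto
  have "C_edge T C ((p @ [v]) ! i) ((p @ [v]) ! Suc i)" if "Suc i < length (p @ [v])" for i
  proof (cases "Suc i < length p")
    case True
    then show ?thesis using p(1) by (simp add: C_path_def nth_append)
  next
    case False
    with that have i: "Suc i = length p" by auto
    then have "p ! i = u" using p(2,3) by (metis diff_Suc_1 last_conv_nth)
    with i show ?thesis using e by (simp add: nth_append)
  qed
  then have "C_path T C (p @ [v])" using p(1) uv by (auto simp: C_path_def)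
  then have "Suc (Max (?A u)) \<in> ?A v"
    using p by (intro CollectI exI[of _ "p @ [v]"]) auto
  then show ?thesis using Max_ge[OF fin] by (fastforce simp: ell_at_def)
qed

lemma two_pos_iff:
  "two_pos d \<longleftrightarrow> 0 < d $ 1 \<and> 0 < d $ 2 \<or> 0 < d $ 1 \<and> 0 < d $ 3 \<or> 0 < d $ 2 \<and> 0 < d $ 3"
proof -
  have "{c. 0 < d $ c} = (if 0 < d $ 1 then {1} else {}) \<union> (if 0 < d $ 2 then {2} else {})
          \<union> (if 0 < d $ 3 then {3} else {})"
    (is "_ = ?R")
  proof (rule set_eqI)
    fix x :: 3
    show "x \<in> {c. 0 < d $ c} \<longleftrightarrow> x \<in> ?R"
      using exhaust_3[of x] by (elim disjE) simp_all
  qed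
  then show ?thesis by (simp add: two_pos_def card_insert_if)
qed

text \<open>In particular, the order on a record set is the order of the vertices.\<close>

lemma is_listing_Record:
  assumes "tournament T"
  shows "is_listing (Record T) (map (record_triple T) [0..<nverts T])"
proof -
  have tp: "two_pos (record_triple T v - record_triple T u)" if "u < v" "v < nverts T" for u v
  proof -
    have "ecol T u v \<noteq> None"
      using assms that by (simp add: tournament_def)
    then obtain c where c: "ecol T u v = Some c" by auto
    have "ell_at T C u < ell_at T C v" if "c \<in> C" for C
      using c that by (intro ell_at_less[OF assms]) (auto simp: C_edge_def)
    from this[of RGK] this[of RBK] this[of GBK] show ?thesis
      unfolding two_pos_iff record_triple_def by (cases c) simp_all
  qed
  have "record_triple T u \<noteq> record_triple T v" if "u < v" "v < nverts T" for u v
    using tp[OF that] by (auto simp: two_pos_iff)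
  then have "inj_on (record_triple T) {..<nverts T}"
    by (intro linorder_inj_onI') (auto)
  then show ?thesis
    using tp by (auto simp: is_listing_def Record_def card_image atLeast0LessThan)
qed

lemma ordered_Record: "tournament T \<Longrightarrow> ordered (Record T)"
  unfolding ordered_def using is_listing_Record
  by (metis List.finite_set is_listing_def)

definition canonical :: "rgbk \<Rightarrow> bool" where
  "canonical T \<longleftrightarrow> Color (Record T) = T \<and> Dual (Color (Record (Dual T))) = T"

definition geometric :: "rgbk \<Rightarrow> bool" where
  "geometric T \<longleftrightarrow> (\<exists>S. ordered S \<and> T = Color S)"

section \<open>Stratifications\<close>

definition stratum :: "rgbk \<Rightarrow> color set \<Rightarrow> nat \<Rightarrow> nat set" where
  "stratum T C l = {v. v < nverts T \<and> ell_at T C v = l}"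

definition strata :: "rgbk \<Rightarrow> color set \<Rightarrow> nat set list" where
  "strata T C = map (stratum T C) [1..<Suc (ell T C)]"

definition geometric_stratification :: "rgbk \<Rightarrow> color set \<Rightarrow> bool" where
  "geometric_stratification T C \<longleftrightarrow>
     (\<forall>i\<in>{1..ell T C}. \<forall>j\<in>{1..ell T C}. \<forall>u\<in>stratum T C i. \<forall>v\<in>stratum T C j.
        u < v \<longrightarrow> (C_edge T C u v \<longleftrightarrow> i < j))"

definition min_vertices :: "rgbk \<Rightarrow> color set \<Rightarrow> nat list" where
  "min_vertices T C = map Min (strata T C)"

text \<open>Vertex \<open>v\<close> of \<open>Dual T\<close> is vertex \<open>nverts T - 1 - v\<close> of \<open>T\<close>.\<close>

definition dual_strata :: "rgbk \<Rightarrow> color set \<Rightarrow> nat set list" where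
  "dual_strata T C = map ((`) (\<lambda>v. nverts T - 1 - v)) (strata (Dual T) C)"

definition max_vertices :: "rgbk \<Rightarrow> color set \<Rightarrow> nat list" where
  "max_vertices T C = map (\<lambda>v. nverts T - 1 - v) (min_vertices (Dual T) C)"

definition increasing_C_path :: "rgbk \<Rightarrow> color set \<Rightarrow> nat list \<Rightarrow> bool" where
  "increasing_C_path T C p \<longleftrightarrow> sorted_wrt (<) p \<and>
     (\<forall>i. Suc i < length p \<longrightarrow> C_edge T C (p ! i) (p ! Suc i))"

text \<open>
  The first dual stratum consists of the vertices at which no \<open>C\<close>-colored edge starts, so the
  maximal vertices increase in the order opposite to their numbering.
\<close>

definition stratification_condition :: "rgbk \<Rightarrow> color set \<Rightarrow> bool" where
  "stratification_condition T C \<longleftrightarrow>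
     geometric_stratification T C \<and>
     increasing_C_path T C (min_vertices T C) \<and>
     increasing_C_path T C (rev (max_vertices T C)) \<and>
     dual_strata T C = rev (strata T C)"

section \<open>Reduced sets\<close>

definition pos_integer_points :: "(real ^ 3) set" where
  "pos_integer_points = {p. \<forall>c. p $ c \<in> \<int> \<and> 0 < p $ c}"

definition reduced :: "(real ^ 3) set \<Rightarrow> bool" where
  "reduced S \<longleftrightarrow> ordered S \<and> S \<subseteq> pos_integer_points \<and>
     (\<forall>c. \<forall>p\<in>S. 2 \<le> p $ c \<longrightarrow> (\<exists>q\<in>S. q $ c = p $ c - 1 \<and> two_pos (p - q)))"

definition reflection_vector :: "rgbk \<Rightarrow> real ^ 3" where
  "reflection_vector T =
     vector [1 + real (ell T RGK), 1 + real (ell T RBK), 1 + real (ell T GBK)]"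

definition reduced_realization :: "rgbk \<Rightarrow> (real ^ 3) set \<Rightarrow> bool" where
  "reduced_realization T S \<longleftrightarrow> ordered S \<and> T = Color S \<and>
     reduced S \<and> reduced ((\<lambda>s. reflection_vector T - s) ` S)"

end

theory Submission
  imports Defs
begin

text \<open>
  The whole equivalence reduces to one condition: for each of the three color classes \<open>C\<close>, the
  \<open>C\<close>-stratifications of \<open>T\<close> and of \<open>Dual T\<close> are both geometric.

  For canonical tournaments this is a matter of unfolding.  The coordinates of the record of a
  vertex are its levels \<open>ell_at\<close>, and a color is determined by which of the three classes contain
  it; so \<open>T\<close> is fixed under \<open>Color \<circ> Record\<close> iff edges compare levels
  (\<open>Color_Record_iff\<close>, \<open>canonical_iff\<close>).

  For the conditions on strata, the point is \<open>ell_at_dual_ell_at\<close>: if both stratifications are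
  geometric, then the longest \<open>C\<close>-path ending at \<open>v\<close> and the longest one starting at \<open>v\<close> form a
  longest \<open>C\<close>-path of \<open>T\<close>, for every vertex \<open>v\<close>.  This says that the dual strata are the strata in
  reverse; conversely, the reversal turns a geometric stratification of \<open>T\<close> into one of \<open>Dual T\<close>
  (\<open>stratification_condition_iff\<close>).

  For realizations, reducedness of \<open>S\<close> is exactly the recursion satisfied by path lengths, which
  forces \<open>S = Record (Color S)\<close> (\<open>reduced_eq_Record\<close>); this also gives uniqueness.  Reflecting
  \<open>S\<close> dualizes \<open>Color S\<close> (\<open>Color_reflection\<close>), so the reflected set, being reduced, must be the
  record of \<open>Dual T\<close>, and \<open>T\<close> is canonical.  In the other direction all records are reduced, and
  the complementarity of the two levels says that reflecting \<open>Record T\<close> gives \<open>Record (Dual T)\<close>.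
\<close>

section \<open>Levels of a single color class\<close>

lemma ell_at_witness:
  assumes "tournament T" "v < nverts T"
  obtains p where "C_path T C p" "p \<noteq> []" "last p = v" "length p = ell_at T C v"
proof -
  let ?A = "{length p |p. C_path T C p \<and> p \<noteq> [] \<and> last p = v}"
  have "1 \<in> ?A" using assms(2) by (intro CollectI exI[of _ "[v]"]) (auto simp: C_path_def)
  then have "Max ?A \<in> ?A" using finite_path_lengths[OF assms(1)] by (intro Max_in) auto
  then show ?thesis using that by (auto simp: ell_at_def)
qed

lemma length_le_ell_at:
  assumes "tournament T" "C_path T C p" "p \<noteq> []"
  shows "length p \<le> ell_at T C (last p)"
proof -
  let ?A = "{length q |q. C_path T C q \<and> q \<noteq> [] \<and> last q = last p}"
  have "length p \<in> ?A" by (intro CollectI exI[of _ p]) (simp add: assms)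
  then show ?thesis
    unfolding ell_at_def by (rule Max_ge[OF finite_path_lengths[OF assms(1)]])
qed

lemma ell_at_pos:
  assumes T: "tournament T" and v: "v < nverts T"
  shows "1 \<le> ell_at T C v"
proof -
  have "C_path T C [v]" using v by (simp add: C_path_def)
  from length_le_ell_at[OF T this] show ?thesis by simp
qed

lemma ell_at_pred:
  assumes T: "tournament T" and v: "v < nverts T" "2 \<le> ell_at T C v"
  obtains u where "C_edge T C u v" "ell_at T C v = Suc (ell_at T C u)"
proof -
  obtain p where p: "C_path T C p" "p \<noteq> []" "last p = v" "length p = ell_at T C v"
    using ell_at_witness[OF T v(1)] .
  then obtain q where q: "p = q @ [v]" by (metis append_butlast_last_id)
  with p v have ne: "q \<noteq> []" by auto
  have "C_path T C q"
    unfolding C_path_def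
  proof (intro conjI allI impI)
    have "set p \<subseteq> {..<nverts T}" using p(1) unfolding C_path_def by blast
    then show "set q \<subseteq> {..<nverts T}" by (simp add: q)
  next
    fix i assume i: "Suc i < length q"
    then have "Suc i < length p" by (simp add: q)
    then have "C_edge T C (p ! i) (p ! Suc i)" using p(1) unfolding C_path_def by blast
    then show "C_edge T C (q ! i) (q ! Suc i)" using i by (simp add: q nth_append)
  qed
  then have le: "length q \<le> ell_at T C (last q)" using length_le_ell_at[OF T _ ne] by simp
  have "Suc (length q - 1) < length p" using ne by (simp add: q)
  then have "C_edge T C (p ! (length q - 1)) (p ! Suc (length q - 1))"
    using p(1) unfolding C_path_def by blast
  then have e: "C_edge T C (last q) v"
    using ne by (simp add: q nth_append last_conv_nth)
  show ?thesis
    using that[OF e] ell_at_less[OF T e] le p(4) q by simp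
qed

text \<open>
  Induction along the vertex order: a predecessor one level below pushes \<open>ell_at\<close> up to \<open>f\<close>, and
  monotonicity of \<open>f\<close> along edges keeps it from exceeding \<open>f\<close>.  This is what makes a reduced set
  remember the path lengths, so that coordinates can be recovered from colors.
\<close>

lemma ell_at_unique:
  assumes T: "tournament T"
    and pos: "\<And>v. v < nverts T \<Longrightarrow> 1 \<le> f v"
    and less: "\<And>u v. C_edge T C u v \<Longrightarrow> f u < f v"
    and pred: "\<And>v. v < nverts T \<Longrightarrow> 2 \<le> f v \<Longrightarrow> \<exists>u. C_edge T C u v \<and> f v = Suc (f u)"
    and "v < nverts T"
  shows "ell_at T C v = f v"
  using assms(5)
proof (induction v rule: less_induct)
  case (less v)
  have IH: "ell_at T C u = f u" if "C_edge T C u v" for u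
    using C_edgeD[OF T that] less by simp
  have "f v \<le> ell_at T C v"
  proof (cases "2 \<le> f v")
    case True
    then obtain u where "C_edge T C u v" "f v = Suc (f u)" using pred less.prems by blast
    then show ?thesis using IH ell_at_less[OF T, of C u v] by simp
  next
    case False
    then show ?thesis using ell_at_pos[OF T less.prems, of C] by simp
  qed
  moreover have "ell_at T C v \<le> f v"
  proof (cases "2 \<le> ell_at T C v")
    case True
    then obtain u where u: "C_edge T C u v" "ell_at T C v = Suc (ell_at T C u)"
      using ell_at_pred[OF T less.prems] by blast
    then show ?thesis using IH assms(3)[of u v] by simp
  next
    case False
    then show ?thesis using pos[OF less.prems] by simp
  qed
  ultimately show ?case by simp
qed

lemma ell_at_le_ell:
  assumes "tournament T" "v < nverts T"
  shows "ell_at T C v \<le> ell T C"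
proof -
  obtain p where p: "C_path T C p" "p \<noteq> []" "last p = v" "length p = ell_at T C v"
    by (rule ell_at_witness[OF assms])
  have "finite {length p |p. C_path T C p}"
    using finite_path_lengths[OF assms(1), of C "\<lambda>_. True"] by simp
  then have "length p \<le> ell T C" unfolding ell_def using p(1) by (intro Max_ge) auto
  with p(4) show ?thesis by simp
qed

lemma ell_at_surj:
  assumes T: "tournament T" and i: "1 \<le> i" "i \<le> ell T C"
  obtains v where "v < nverts T" "ell_at T C v = i"
proof -
  have "\<exists>v<nverts T. ell_at T C v = i"
    using i(2,1)
  proof (induction i rule: inc_induct)
    case base
    let ?A = "{length p |p. C_path T C p}"
    have "length [] \<in> ?A" by (intro CollectI exI[of _ "[]"]) (auto simp: C_path_def)
    then have "Max ?A \<in> ?A"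
      using finite_path_lengths[OF T, of C "\<lambda>_. True"] by (intro Max_in) auto
    then obtain p where p: "C_path T C p" "length p = ell T C" by (auto simp: ell_def)
    with base have ne: "p \<noteq> []" by auto
    with p have last: "last p < nverts T" by (force simp: C_path_def)
    then have "ell_at T C (last p) = ell T C"
      using length_le_ell_at[OF T p(1) ne] ell_at_le_ell[OF T last, of C] p(2) by simp
    with last show ?case by blast
  next
    case (step n)
    then obtain v where v: "v < nverts T" "ell_at T C v = Suc n" by auto
    have "2 \<le> ell_at T C v" using v step.prems by simp
    then obtain u where u: "C_edge T C u v" "ell_at T C v = Suc (ell_at T C u)"
      by (rule ell_at_pred[OF T v(1)])
    then show ?case using v C_edgeD[OF T u(1)] by (intro exI[of _ u]) simp
  qed
  then show ?thesis using that by blast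
qed

lemma geometric_stratification_iff:
  assumes "tournament T"
  shows "geometric_stratification T C \<longleftrightarrow>
    (\<forall>u v. u < v \<and> v < nverts T \<longrightarrow> (C_edge T C u v \<longleftrightarrow> ell_at T C u < ell_at T C v))"
proof -
  let ?P = "\<lambda>u v. u < v \<longrightarrow> (C_edge T C u v \<longleftrightarrow> ell_at T C u < ell_at T C v)"
  have level: "v \<in> stratum T C i \<longleftrightarrow> v < nverts T \<and> i = ell_at T C v" for v i
    by (auto simp: stratum_def)
  have range: "ell_at T C v \<in> {1..ell T C}" if "v < nverts T" for v
    using that ell_at_pos[OF assms] ell_at_le_ell[OF assms] by simp
  have geo: "geometric_stratification T C \<longleftrightarrow>
      (\<forall>u v. u < nverts T \<longrightarrow> v < nverts T \<longrightarrow> ?P u v)"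
    unfolding geometric_stratification_def Ball_def level using range by blast
  show ?thesis
  proof
    assume "geometric_stratification T C"
    then have "?P u v" if "u < nverts T" "v < nverts T" for u v using that geo by simp
    then show "\<forall>u v. u < v \<and> v < nverts T \<longrightarrow>
        (C_edge T C u v \<longleftrightarrow> ell_at T C u < ell_at T C v)" by simp
  next
    assume "\<forall>u v. u < v \<and> v < nverts T \<longrightarrow>
        (C_edge T C u v \<longleftrightarrow> ell_at T C u < ell_at T C v)"
    then show "geometric_stratification T C" unfolding geo by simp
  qed
qed

text \<open>
  Each vertex of level \<open>i + 1\<close> is reached from some vertex of level \<open>i\<close>, so the first vertex of
  level \<open>i\<close> comes earlier; the stratification being geometric then supplies the edge.
\<close>

lemma increasing_min_vertices:
  assumes T: "tournament T" and geo: "geometric_stratification T C"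
  shows "increasing_C_path T C (min_vertices T C)"
proof -
  define w where "w = (\<lambda>i. Min (stratum T C i))"
  have fin: "finite (stratum T C i)" for i by (simp add: stratum_def)
  have w: "w i < nverts T \<and> ell_at T C (w i) = i" if "1 \<le> i" "i \<le> ell T C" for i
  proof -
    have "stratum T C i \<noteq> {}" using ell_at_surj[OF T that] by (auto simp: stratum_def)
    then have "w i \<in> stratum T C i" using fin by (simp add: w_def)
    then show ?thesis by (simp add: stratum_def)
  qed
  have nth: "length (min_vertices T C) = ell T C"
    "i < ell T C \<Longrightarrow> min_vertices T C ! i = w (Suc i)" for i
    by (simp_all add: min_vertices_def strata_def w_def del: upt_Suc)
  have e: "C_edge T C (w i) (w (Suc i))" if i: "1 \<le> i" "Suc i \<le> ell T C" for i
  proof -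
    have wi: "w i < nverts T" "ell_at T C (w i) = i"
      and ws: "w (Suc i) < nverts T" "ell_at T C (w (Suc i)) = Suc i"
      using i by (simp_all add: w)
    have "2 \<le> ell_at T C (w (Suc i))" using ws(2) i by simp
    then obtain u where u: "C_edge T C u (w (Suc i))"
        "ell_at T C (w (Suc i)) = Suc (ell_at T C u)"
      by (rule ell_at_pred[OF T ws(1)])
    then have "ell_at T C u = i" using ws(2) by simp
    then have "u \<in> stratum T C i" using C_edgeD[OF T u(1)] by (simp add: stratum_def)
    then have "w i \<le> u" using fin by (simp add: w_def)
    also have "u < w (Suc i)" using C_edgeD[OF T u(1)] by simp
    finally show ?thesis using geo wi ws by (simp add: geometric_stratification_iff[OF T])
  qed
  have "C_edge T C (min_vertices T C ! i) (min_vertices T C ! Suc i)"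
    if "Suc i < length (min_vertices T C)" for i
    using e[of "Suc i"] that by (simp add: nth)
  moreover from this have "sorted_wrt (<) (min_vertices T C)"
    unfolding sorted_wrt_iff_nth_Suc_transp[OF transp_on_less] using C_edgeD(1)[OF T] by blast
  ultimately show ?thesis by (simp add: increasing_C_path_def)
qed

section \<open>Duality\<close>

lemma nverts_Dual [simp]: "nverts (Dual T) = nverts T"
  by (simp add: Dual_def)

lemma ecol_eq_None_iff:
  assumes "tournament T"
  shows "ecol T i j = None \<longleftrightarrow> \<not> (i < j \<and> j < nverts T)"
  using assms[unfolded tournament_def, rule_format, of i j] by blast

lemma tournament_Dual:
  assumes "tournament T"
  shows "tournament (Dual T)"
  unfolding tournament_def
proof (intro allI)
  fix i j
  show "ecol (Dual T) i j \<noteq> None \<longleftrightarrow> i < j \<and> j < nverts (Dual T)"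
    by (cases "i < j \<and> j < nverts T")
      (auto simp: Dual_def ecol_eq_None_iff[OF assms] simp del: not_None_eq)
qed

lemma Dual_Dual:
  assumes "tournament T"
  shows "Dual (Dual T) = T"
proof -
  have "ecol (Dual (Dual T)) i j = ecol T i j" for i j
    using ecol_eq_None_iff[OF assms, of i j]
    by (cases "i < j \<and> j < nverts T") (auto simp: Dual_def)
  then show ?thesis by (intro rgbk.equality) (auto simp: fun_eq_iff)
qed

lemma C_edge_Dual:
  assumes "u < nverts T" "v < nverts T" "tournament T"
  shows "C_edge (Dual T) C (nverts T - 1 - v) (nverts T - 1 - u) \<longleftrightarrow> C_edge T C u v"
proof (cases "u < v")
  case True
  then have "nverts T - 1 - v < nverts T - 1 - u" "nverts T - 1 - u < nverts T"
    using assms by linarith+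
  then show ?thesis using assms by (simp add: C_edge_def Dual_def)
next
  case False
  then have "\<not> C_edge T C u v" using C_edgeD(1)[OF assms(3)] by blast
  moreover have "\<not> nverts T - 1 - v < nverts T - 1 - u" using False by simp
  then have "\<not> C_edge (Dual T) C (nverts T - 1 - v) (nverts T - 1 - u)"
    using C_edgeD(1)[OF tournament_Dual[OF assms(3)]] by blast
  ultimately show ?thesis by simp
qed

text \<open>
  Expressed at the vertex of \<open>T\<close>, this is the longest path starting there, so that both levels can
  be compared without renumbering.
\<close>

definition dual_ell_at :: "rgbk \<Rightarrow> color set \<Rightarrow> nat \<Rightarrow> nat" where
  "dual_ell_at T C v = ell_at (Dual T) C (nverts T - 1 - v)"

lemma dual_ell_at_pos: "tournament T \<Longrightarrow> v < nverts T \<Longrightarrow> 1 \<le> dual_ell_at T C v"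
  unfolding dual_ell_at_def by (rule ell_at_pos[OF tournament_Dual]) auto

lemma dual_ell_at_succ:
  assumes T: "tournament T" and v: "v < nverts T" "2 \<le> dual_ell_at T C v"
  obtains u where "C_edge T C v u" "dual_ell_at T C v = Suc (dual_ell_at T C u)"
proof -
  have DT: "tournament (Dual T)" using T by (rule tournament_Dual)
  obtain u where u: "C_edge (Dual T) C u (nverts T - 1 - v)"
      "dual_ell_at T C v = Suc (ell_at (Dual T) C u)"
    using ell_at_pred[OF DT, of "nverts T - 1 - v" C] v by (auto simp: dual_ell_at_def)
  then have "u < nverts T" using C_edgeD[OF DT u(1)] by simp
  with u v that[of "nverts T - 1 - u"] C_edge_Dual[OF v(1), of "nverts T - 1 - u" C] T
  show ?thesis by (simp add: dual_ell_at_def)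
qed

text \<open>The sum counts the vertices of a path through \<open>v\<close>, with \<open>v\<close> counted twice.\<close>

lemma ell_at_dual_ell_at_le:
  assumes T: "tournament T" and "v < nverts T"
  shows "ell_at T C v + dual_ell_at T C v \<le> Suc (ell T C)"
  using assms(2)
proof (induction "dual_ell_at T C v" arbitrary: v rule: less_induct)
  case less
  show ?case
  proof (cases "2 \<le> dual_ell_at T C v")
    case True
    then obtain u where u: "C_edge T C v u" "dual_ell_at T C v = Suc (dual_ell_at T C u)"
      using dual_ell_at_succ[OF T less.prems] by blast
    then show ?thesis
      using less.hyps[of u] C_edgeD[OF T u(1)] ell_at_less[OF T u(1)] by simp
  next
    case False
    then show ?thesis using ell_at_le_ell[OF T less.prems, of C] by simp
  qed
qed

lemma ell_Dual:
  assumes "tournament T"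
  shows "ell (Dual T) C = ell T C"
proof -
  have le: "ell (Dual T) C \<le> ell T C" if T: "tournament T" for T
  proof (cases "ell (Dual T) C = 0")
    case False
    then obtain v where v: "v < nverts T" "ell_at (Dual T) C v = ell (Dual T) C"
      using ell_at_surj[OF tournament_Dual[OF T], of "ell (Dual T) C" C] by auto
    have "nverts T - 1 - v < nverts T" using v by simp
    from ell_at_dual_ell_at_le[OF T this, of C] ell_at_pos[OF T this, of C] v show ?thesis
      by (simp add: dual_ell_at_def)
  qed simp
  show ?thesis using le[OF assms] le[OF tournament_Dual[OF assms]] Dual_Dual[OF assms] by simp
qed

lemma geometric_stratification_Dual_iff:
  assumes T: "tournament T"
  shows "geometric_stratification (Dual T) C \<longleftrightarrow>
    (\<forall>u v. u < v \<and> v < nverts T \<longrightarrow>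
      (C_edge T C u v \<longleftrightarrow> dual_ell_at T C v < dual_ell_at T C u))" (is "_ \<longleftrightarrow> ?R")
proof -
  let ?r = "\<lambda>v. nverts T - 1 - v"
  let ?P = "\<lambda>u v. C_edge (Dual T) C u v \<longleftrightarrow> ell_at (Dual T) C u < ell_at (Dual T) C v"
  have P: "?P (?r v) (?r u) \<longleftrightarrow> (C_edge T C u v \<longleftrightarrow> dual_ell_at T C v < dual_ell_at T C u)"
    if "u < v" "v < nverts T" for u v
    using that C_edge_Dual[of u T v C] T by (simp add: dual_ell_at_def)
  have "(\<forall>u v. u < v \<and> v < nverts T \<longrightarrow> ?P u v) \<longleftrightarrow>
      (\<forall>u v. u < v \<and> v < nverts T \<longrightarrow> ?P (?r v) (?r u))" (is "?A \<longleftrightarrow> ?B")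
  proof
    assume A: ?A
    show ?B
    proof (intro allI impI)
      fix u v assume "u < v \<and> v < nverts T"
      then have "?r v < ?r u \<and> ?r u < nverts T" by linarith
      with A show "?P (?r v) (?r u)" by blast
    qed
  next
    assume B: ?B
    show ?A
    proof (intro allI impI)
      fix u v assume uv: "u < v \<and> v < nverts T"
      then have "?r v < ?r u \<and> ?r u < nverts T" by linarith
      then have "?P (?r (?r u)) (?r (?r v))" using B by blast
      moreover have "?r (?r u) = u" "?r (?r v) = v" using uv by auto
      ultimately show "?P u v" by simp
    qed
  qed
  also have "\<dots> \<longleftrightarrow> ?R" using P by blast
  finally show ?thesis
    using geometric_stratification_iff[OF tournament_Dual[OF T], of C] by simp
qed

text \<open>
  The sum cannot exceed the bound; that it reaches it follows by induction on the dual level \<open>j\<close>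
  of \<open>v\<close>, descending from \<open>ell T C\<close>.  If \<open>w\<close> is the last vertex of dual level \<open>j\<close>,
  then some \<open>x\<close> of dual level \<open>j + 1\<close> has an edge into dual level \<open>j\<close>, hence precedes \<open>w\<close> and, the
  dual stratification being geometric, has an edge to \<open>w\<close>.  So \<open>w\<close> lies above \<open>x\<close>; and \<open>v\<close> is not
  below \<open>w\<close>, because equal dual levels exclude an edge from \<open>v\<close> to \<open>w\<close>, while the
  stratification of \<open>T\<close> would demand one if the level of \<open>v\<close> were smaller.
\<close>

lemma ell_at_dual_ell_at:
  assumes T: "tournament T"
    and geo: "geometric_stratification T C" "geometric_stratification (Dual T) C"
    and "v < nverts T"
  shows "ell_at T C v + dual_ell_at T C v = Suc (ell T C)"
proof -
  have DT: "tournament (Dual T)" using T by (rule tournament_Dual)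
  have dual_surj: "\<exists>x<nverts T. dual_ell_at T C x = j" if j: "1 \<le> j" "j \<le> ell T C" for j
  proof -
    obtain y where "y < nverts T" "ell_at (Dual T) C y = j"
      using ell_at_surj[OF DT, of j C] j ell_Dual[OF T] by auto
    then show ?thesis by (intro exI[of _ "nverts T - 1 - y"]) (simp add: dual_ell_at_def)
  qed
  have "Suc (ell T C) \<le> ell_at T C v + j"
    if "j \<le> ell T C" "1 \<le> j" "v < nverts T" "dual_ell_at T C v = j" for j v
    using that
  proof (induction j arbitrary: v rule: inc_induct)
    case base
    then show ?case using ell_at_pos[OF T, of v C] by simp
  next
    case (step j)
    let ?D = "{w. w < nverts T \<and> dual_ell_at T C w = j}"
    define w where "w = Max ?D"
    have ge: "u \<le> w" if "u < nverts T" "dual_ell_at T C u = j" for u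
      using that unfolding w_def by (intro Max_ge) auto
    have "w \<in> ?D" unfolding w_def using step.prems by (intro Max_in) auto
    then have w: "w < nverts T" "dual_ell_at T C w = j" by auto
    obtain x where x: "x < nverts T" "dual_ell_at T C x = Suc j"
      using dual_surj[of "Suc j"] step.hyps by auto
    have "2 \<le> dual_ell_at T C x" using x(2) step.prems by simp
    then obtain u where u: "C_edge T C x u" "dual_ell_at T C x = Suc (dual_ell_at T C u)"
      by (rule dual_ell_at_succ[OF T x(1)])
    then have "x < w" using ge[of u] C_edgeD[OF T u(1)] x(2) by simp
    then have "C_edge T C x w"
      using geo(2) w x by (simp add: geometric_stratification_Dual_iff[OF T])
    then have "ell_at T C x < ell_at T C w" by (rule ell_at_less[OF T])
    moreover have "Suc (ell T C) \<le> ell_at T C x + Suc j"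
      using step.IH[of x] x by simp
    moreover have "ell_at T C w \<le> ell_at T C v"
    proof (cases "v = w")
      case False
      then have "v < w" using ge[OF step.prems(2,3)] by simp
      then have "\<not> C_edge T C v w" "\<not> ell_at T C v < ell_at T C w \<or> C_edge T C v w"
        using geo w step.prems
        by (simp_all add: geometric_stratification_Dual_iff[OF T] geometric_stratification_iff[OF T])
      then show ?thesis by simp
    qed simp
    ultimately show ?case by simp
  qed
  from this[of "dual_ell_at T C v" v] assms(4) dual_ell_at_pos[OF T assms(4), of C]
    ell_at_dual_ell_at_le[OF T assms(4), of C] ell_at_pos[OF T assms(4), of C]
  show ?thesis by simp
qed

text \<open>
  The list reversal puts the vertices of dual level \<open>k + 1\<close> against those of level \<open>ell T C - k\<close>.
\<close>

lemma dual_strata_eq_iff: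
  assumes T: "tournament T"
  shows "dual_strata T C = rev (strata T C) \<longleftrightarrow>
    (\<forall>v<nverts T. ell_at T C v + dual_ell_at T C v = Suc (ell T C))" (is "_ \<longleftrightarrow> ?R")
proof -
  let ?m = "ell T C" and ?D = "\<lambda>k. {v. v < nverts T \<and> dual_ell_at T C v = k}"
  have img: "(\<lambda>v. nverts T - 1 - v) ` stratum (Dual T) C k = ?D k" for k
  proof (intro equalityI subsetI)
    fix v assume "v \<in> ?D k"
    then show "v \<in> (\<lambda>v. nverts T - 1 - v) ` stratum (Dual T) C k"
      by (intro image_eqI[of _ _ "nverts T - 1 - v"]) (auto simp: stratum_def dual_ell_at_def)
  qed (auto simp: stratum_def dual_ell_at_def)
  have len: "length (dual_strata T C) = ?m" "length (rev (strata T C)) = ?m"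
    by (simp_all add: dual_strata_def strata_def ell_Dual[OF T] del: upt_Suc)
  have nth: "dual_strata T C ! k = ?D (Suc k)" "rev (strata T C) ! k = stratum T C (?m - k)"
    if "k < ?m" for k
  proof -
    have "dual_strata T C ! k = (\<lambda>v. nverts T - 1 - v) ` stratum (Dual T) C (Suc k)"
      using that by (simp add: dual_strata_def strata_def ell_Dual[OF T] del: upt_Suc)
    then show "dual_strata T C ! k = ?D (Suc k)" by (simp only: img)
    show "rev (strata T C) ! k = stratum T C (?m - k)"
      using that by (simp add: strata_def rev_nth Suc_diff_Suc del: upt_Suc)
  qed
  have "dual_strata T C = rev (strata T C) \<longleftrightarrow>
      (\<forall>k<?m. ?D (Suc k) = stratum T C (?m - k))"
    using nth by (simp add: list_eq_iff_nth_eq len del: length_rev)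
  also have "\<dots> \<longleftrightarrow> ?R"
  proof
    assume L: "\<forall>k<?m. ?D (Suc k) = stratum T C (?m - k)"
    show ?R
    proof (intro allI impI)
      fix v assume v: "v < nverts T"
      have b: "1 \<le> ell_at T C v" "ell_at T C v \<le> ?m"
        using v ell_at_pos[OF T] ell_at_le_ell[OF T] by auto
      then have "v \<in> stratum T C (?m - (?m - ell_at T C v))" using v by (simp add: stratum_def)
      moreover have "?m - ell_at T C v < ?m" using b by simp
      ultimately have "v \<in> ?D (Suc (?m - ell_at T C v))" using L by blast
      then show "ell_at T C v + dual_ell_at T C v = Suc ?m" using b by simp
    qed
  next
    assume R: ?R
    show "\<forall>k<?m. ?D (Suc k) = stratum T C (?m - k)"
    proof (intro allI impI set_eqI)
      fix k v assume "k < ?m"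
      then show "v \<in> ?D (Suc k) \<longleftrightarrow> v \<in> stratum T C (?m - k)"
        using R[rule_format, of v] by (auto simp: stratum_def)
    qed
  qed
  finally show ?thesis .
qed

lemma increasing_C_path_Dual:
  assumes T: "tournament T" and p: "increasing_C_path (Dual T) C p" and "set p \<subseteq> {..<nverts T}"
  shows "increasing_C_path T C (rev (map (\<lambda>v. nverts T - 1 - v) p))"
proof -
  let ?q = "rev (map (\<lambda>v. nverts T - 1 - v) p)"
  have e: "C_edge T C (?q ! i) (?q ! Suc i)" if i: "Suc i < length ?q" for i
  proof -
    let ?k = "length p - Suc (Suc i)"
    have k: "Suc ?k < length p" "length p - Suc i = Suc ?k" using i by auto
    then have "C_edge (Dual T) C (p ! ?k) (p ! Suc ?k)"
      using p by (simp add: increasing_C_path_def)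
    moreover have "p ! ?k < nverts T" "p ! Suc ?k < nverts T"
      using assms(3) k(1) nth_mem[of ?k p] nth_mem[of "Suc ?k" p] by (blast dest: Suc_lessD)+
    ultimately have "C_edge T C (nverts T - 1 - p ! Suc ?k) (nverts T - 1 - p ! ?k)"
      using C_edge_Dual[of "p ! ?k" "Dual T" "p ! Suc ?k" C] T Dual_Dual[OF T] tournament_Dual[OF T]
      by simp
    then show ?thesis using i k by (simp add: rev_nth)
  qed
  moreover from this have "sorted_wrt (<) ?q"
    unfolding sorted_wrt_iff_nth_Suc_transp[OF transp_on_less] using C_edgeD(1)[OF T] by blast
  ultimately show ?thesis unfolding increasing_C_path_def by blast
qed

lemma min_vertices_less:
  assumes "tournament T"
  shows "set (min_vertices T C) \<subseteq> {..<nverts T}"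
proof -
  have "Min (stratum T C i) < nverts T" if i: "1 \<le> i" "i \<le> ell T C" for i
  proof -
    have "stratum T C i \<noteq> {}" using ell_at_surj[OF assms i] by (auto simp: stratum_def)
    then have "Min (stratum T C i) \<in> stratum T C i" by (intro Min_in) (auto simp: stratum_def)
    then show ?thesis by (simp add: stratum_def)
  qed
  then show ?thesis by (auto simp: min_vertices_def strata_def simp del: upt_Suc)
qed

text \<open>
  If the levels from both ends add up to a constant, then comparing levels is comparing dual
  levels in reverse, so that one geometric stratification yields the other.  In the other direction
  the paths of minimal and maximal vertices come from the stratifications of \<open>T\<close> and \<open>Dual T\<close>
  respectively.
\<close>

lemma stratification_condition_iff:
  assumes T: "tournament T"
  shows "stratification_condition T C \<longleftrightarrow>
    geometric_stratification T C \<and> geometric_stratification (Dual T) C"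
proof
  assume "stratification_condition T C"
  then have geo: "geometric_stratification T C"
    and sum: "\<And>v. v < nverts T \<Longrightarrow> ell_at T C v + dual_ell_at T C v = Suc (ell T C)"
    by (auto simp: stratification_condition_def dual_strata_eq_iff[OF T])
  have "ell_at T C u < ell_at T C v \<longleftrightarrow> dual_ell_at T C v < dual_ell_at T C u"
    if "u < v" "v < nverts T" for u v
    using sum[of u] sum[of v] that by linarith
  with geo show "geometric_stratification T C \<and> geometric_stratification (Dual T) C"
    by (simp add: geometric_stratification_iff[OF T] geometric_stratification_Dual_iff[OF T])
next
  assume geo: "geometric_stratification T C \<and> geometric_stratification (Dual T) C"
  have DT: "tournament (Dual T)" using T by (rule tournament_Dual)
  have "increasing_C_path (Dual T) C (min_vertices (Dual T) C)"
    using increasing_min_vertices[OF DT] geo by blast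
  then have "increasing_C_path T C (rev (max_vertices T C))"
    unfolding max_vertices_def
    by (rule increasing_C_path_Dual[OF T]) (use min_vertices_less[OF DT] in simp)
  then show "stratification_condition T C"
    using geo increasing_min_vertices[OF T] ell_at_dual_ell_at[OF T]
    by (simp add: stratification_condition_def dual_strata_eq_iff[OF T])
qed

section \<open>Coordinates and color classes\<close>

text \<open>
  The class whose longest paths are recorded in coordinate \<open>c\<close>; equally, the colors that stand for
  a positive difference in coordinate \<open>c\<close>.  Indexing the classes by coordinates lets one argument
  serve for all three.
\<close>

definition coord_class :: "3 \<Rightarrow> color set" where
  "coord_class c = (if c = 1 then RGK else if c = 2 then RBK else GBK)"

lemma coord_class_simps [simp]:
  "coord_class 1 = RGK" "coord_class 2 = RBK" "coord_class 3 = GBK"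
  by (simp_all add: coord_class_def)

lemma ball_coord_class: "(\<forall>C\<in>{RGK, RBK, GBK}. P C) \<longleftrightarrow> (\<forall>c. P (coord_class c))"
  by (simp add: forall_3)

lemma record_triple_nth: "record_triple T v $ c = real (ell_at T (coord_class c) v)"
  using exhaust_3[of c] by (auto simp: record_triple_def)

lemma reflection_vector_nth: "reflection_vector T $ c = 1 + real (ell T (coord_class c))"
  using exhaust_3[of c] by (auto simp: reflection_vector_def)

lemma color_of_in_coord_class:
  assumes "two_pos d"
  shows "color_of d \<in> coord_class c \<longleftrightarrow> 0 < d $ c"
  using assms exhaust_3[of c] by (auto simp: two_pos_iff color_of_def)

lemma tournament_Color: "tournament (Color S)"
  by (simp add: tournament_def Color_def)

lemma C_edge_Color:
  assumes "is_listing S L" "u < v" "v < length L"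
  shows "C_edge (Color S) (coord_class c) u v \<longleftrightarrow> L ! u $ c < L ! v $ c"
proof -
  have "length L = card S" "two_pos (L ! v - L ! u)" using assms by (auto simp: is_listing_def)
  then show ?thesis
    using assms(2,3) color_of_in_coord_class[of "L ! v - L ! u" c]
    by (simp add: C_edge_def Color_def listing_eq[OF assms(1)])
qed

lemma color_eqI:
  assumes "\<And>c. a \<in> coord_class c \<longleftrightarrow> b \<in> coord_class c"
  shows "a = b"
  using assms[of 1] assms[of 2] assms[of 3] by (cases a; cases b) auto

lemma tournament_eqI:
  assumes T: "tournament T" "tournament T'" and n: "nverts T = nverts T'"
    and edge: "\<And>c u v. u < v \<Longrightarrow> v < nverts T \<Longrightarrow>
      C_edge T (coord_class c) u v \<longleftrightarrow> C_edge T' (coord_class c) u v"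
  shows "T = T'"
proof -
  have "ecol T u v = ecol T' u v" for u v
  proof (cases "u < v \<and> v < nverts T")
    case True
    then have "ecol T u v \<noteq> None" "ecol T' u v \<noteq> None"
      using n ecol_eq_None_iff[OF T(1), of u v] ecol_eq_None_iff[OF T(2), of u v] by simp_all
    then obtain a b where ab: "ecol T u v = Some a" "ecol T' u v = Some b" by blast
    have "a = b" using edge[of u v] True ab by (intro color_eqI) (auto simp: C_edge_def)
    with ab show ?thesis by simp
  next
    case False
    then have "ecol T u v = None" "ecol T' u v = None"
      using n ecol_eq_None_iff[OF T(1), of u v] ecol_eq_None_iff[OF T(2), of u v] by simp_all
    then show ?thesis by simp
  qed
  with n show ?thesis by (intro rgbk.equality) (auto simp: fun_eq_iff)
qed

text \<open>
  The points of \<open>Record T\<close> are listed in vertex order, so an edge of \<open>Color (Record T)\<close> lies in the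
  class of coordinate \<open>c\<close> iff the level for that class increases along it.
\<close>

lemma Color_Record_iff:
  assumes T: "tournament T"
  shows "Color (Record T) = T \<longleftrightarrow> (\<forall>c. geometric_stratification T (coord_class c))"
proof -
  note L = is_listing_Record[OF T]
  have n: "nverts (Color (Record T)) = nverts T"
    using L by (simp add: Color_def is_listing_def)
  have e: "C_edge (Color (Record T)) (coord_class c) u v \<longleftrightarrow>
      ell_at T (coord_class c) u < ell_at T (coord_class c) v"
    if "u < v" "v < nverts T" for u v c
    using C_edge_Color[OF L that(1), of c] that by (simp add: record_triple_nth)
  show ?thesis
  proof
    assume "Color (Record T) = T"
    with e show "\<forall>c. geometric_stratification T (coord_class c)"
      by (simp add: geometric_stratification_iff[OF T])
  next
    assume "\<forall>c. geometric_stratification T (coord_class c)"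
    with e show "Color (Record T) = T"
      by (intro tournament_eqI[OF tournament_Color T n])
        (simp add: n geometric_stratification_iff[OF T])
  qed
qed

lemma canonical_iff:
  assumes T: "tournament T"
  shows "canonical T \<longleftrightarrow> (\<forall>c. geometric_stratification T (coord_class c) \<and>
    geometric_stratification (Dual T) (coord_class c))"
proof -
  have "Dual (Color (Record (Dual T))) = T \<longleftrightarrow> Color (Record (Dual T)) = Dual T"
  proof
    assume "Dual (Color (Record (Dual T))) = T"
    from arg_cong[OF this, of Dual] show "Color (Record (Dual T)) = Dual T"
      by (simp add: Dual_Dual[OF tournament_Color])
  qed (simp add: Dual_Dual[OF T])
  then show ?thesis
    by (auto simp: canonical_def Color_Record_iff T tournament_Dual)
qed

section \<open>Reduced sets\<close>

text \<open>
  The point required below a record is the record of the last but one vertex of a longest path.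
\<close>

lemma reduced_Record:
  assumes T: "tournament T"
  shows "reduced (Record T)"
proof -
  have "record_triple T v \<in> pos_integer_points" if "v < nverts T" for v
    using ell_at_pos[OF T that] by (simp add: pos_integer_points_def record_triple_nth Suc_le_eq)
  then have "Record T \<subseteq> pos_integer_points" by (auto simp: Record_def)
  moreover have "\<exists>q\<in>Record T. q $ c = p $ c - 1 \<and> two_pos (p - q)"
    if p: "p \<in> Record T" "2 \<le> p $ c" for p c
  proof -
    obtain v where v: "v < nverts T" "p = record_triple T v" using p(1) by (auto simp: Record_def)
    then have "2 \<le> ell_at T (coord_class c) v" using p(2) by (simp add: record_triple_nth)
    then obtain u where u: "C_edge T (coord_class c) u v"
        "ell_at T (coord_class c) v = Suc (ell_at T (coord_class c) u)"
      by (rule ell_at_pred[OF T v(1)])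
    have uv: "u < v" using C_edgeD[OF T u(1)] by simp
    moreover have "\<forall>i j. i < j \<and> j < nverts T \<longrightarrow> two_pos (record_triple T j - record_triple T i)"
      using is_listing_Record[OF T] by (simp add: is_listing_def)
    ultimately have "two_pos (p - record_triple T u)" using v by blast
    with u uv v show ?thesis
      by (intro bexI[of _ "record_triple T u"]) (auto simp: Record_def record_triple_nth)
  qed
  ultimately show ?thesis using ordered_Record[OF T] by (simp add: reduced_def)
qed

text \<open>
  In a reduced set each coordinate satisfies the characterization of \<open>ell_at\<close> for its color class,
  so the coordinates are determined by the colors.
\<close>

lemma reduced_eq_Record:
  assumes red: "reduced S"
  shows "S = Record (Color S)"
proof -
  obtain L where L: "is_listing S L" using red by (auto simp: reduced_def ordered_def)
  then have S: "S = set L" and len: "length L = nverts (Color S)"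
    and tp: "\<And>i j. i < j \<Longrightarrow> j < length L \<Longrightarrow> two_pos (L ! j - L ! i)"
    by (auto simp: is_listing_def Color_def)
  have "record_triple (Color S) v = L ! v" if v: "v < length L" for v
  proof -
    have "L ! v $ c = real (ell_at (Color S) (coord_class c) v)" for c
    proof -
      define f where "f u = nat \<lfloor>L ! u $ c\<rfloor>" for u
      have f: "real (f u) = L ! u $ c" "1 \<le> f u" if "u < length L" for u
      proof -
        have "L ! u \<in> pos_integer_points" using red that S by (auto simp: reduced_def)
        then have "L ! u $ c \<in> \<int>" and "0 < L ! u $ c" by (simp_all add: pos_integer_points_def)
        then obtain k where "L ! u $ c = of_int k" "0 < L ! u $ c" by (metis Ints_cases)
        then show "real (f u) = L ! u $ c" "1 \<le> f u" by (auto simp: f_def)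
      qed
      have "ell_at (Color S) (coord_class c) v = f v"
      proof (rule ell_at_unique[OF tournament_Color])
        show "1 \<le> f u" if "u < nverts (Color S)" for u
          using that f len by simp
        show "f u < f w" if e: "C_edge (Color S) (coord_class c) u w" for u w
        proof -
          have uw: "u < w" "w < length L" using C_edgeD[OF tournament_Color e] len by auto
          then have "L ! u $ c < L ! w $ c" using C_edge_Color[OF L] e by simp
          then show ?thesis using f(1)[of u] f(1)[of w] uw by simp
        qed
        show "\<exists>u. C_edge (Color S) (coord_class c) u w \<and> f w = Suc (f u)"
          if w: "w < nverts (Color S)" "2 \<le> f w" for w
        proof -
          have wl: "w < length L" using w len by simp
          have "L ! w \<in> S" "2 \<le> L ! w $ c"
            using w(2) f(1)[OF wl] wl S by auto
          then obtain q where q: "q \<in> S" "q $ c = L ! w $ c - 1" "two_pos (L ! w - q)"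
            using red unfolding reduced_def by blast
          then obtain u where u: "u < length L" "q = L ! u" by (auto simp: S in_set_conv_nth)
          \<comment> \<open>The point below precedes in the listing, because \<open>two_pos\<close> is asymmetric.\<close>
          have "\<not> w < u" using tp[of w u] u q(3) two_pos_asym[of "L ! u - L ! w"] by auto
          moreover have "u \<noteq> w" using q(2) u by auto
          ultimately have "u < w" by simp
          then show ?thesis
            using C_edge_Color[OF L _ wl, of u c] u q(2) f(1)[OF wl] f(1)[OF u(1)]
            by (intro exI[of _ u]) auto
        qed
      qed (use v len in simp)
      then show ?thesis using f(1)[OF v] by simp
    qed
    then show ?thesis by (simp add: vec_eq_iff record_triple_nth)
  qed
  then have "Record (Color S) = (!) L ` {..<length L}" by (simp add: Record_def len)
  also have "\<dots> = S" by (auto simp: S set_conv_nth)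
  finally show ?thesis by simp
qed

text \<open>
  Reflection reverses the listing, and reversing the two points of a difference undoes the change
  of sign, so each edge keeps its color.
\<close>

lemma Color_reflection:
  assumes "ordered S"
  shows "Color ((\<lambda>s. a - s) ` S) = Dual (Color S)"
proof -
  obtain L where L: "is_listing S L" using assms by (auto simp: ordered_def)
  let ?L = "rev (map (\<lambda>s. a - s) L)"
  have card: "card ((\<lambda>s. a - s) ` S) = card S" by (intro card_image inj_onI) simp
  have len: "length L = card S" using L by (simp add: is_listing_def)
  have diff: "?L ! j - ?L ! i = L ! (card S - Suc i) - L ! (card S - Suc j)"
    if "i < j" "j < card S" for i j
    using that len by (simp add: rev_nth)
  have "is_listing ((\<lambda>s. a - s) ` S) ?L"
    using L card diff by (auto simp: is_listing_def)
  from listing_eq[OF this] listing_eq[OF L] card diff show ?thesis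
    by (auto simp: Color_def Dual_def fun_eq_iff)
qed

text \<open>
  The length of the path starting at \<open>v\<close> is the reflected length of the path ending at \<open>v\<close>, by the
  complementarity of levels.
\<close>

lemma Record_reflection:
  assumes T: "tournament T" and "canonical T"
  shows "(\<lambda>s. reflection_vector T - s) ` Record T = Record (Dual T)"
proof -
  have refl: "reflection_vector T - record_triple T v = record_triple (Dual T) (nverts T - 1 - v)"
    if "v < nverts T" for v
  proof -
    have "ell_at T (coord_class c) v + dual_ell_at T (coord_class c) v = Suc (ell T (coord_class c))"
      for c
      using ell_at_dual_ell_at[OF T _ _ that] assms(2) canonical_iff[OF T] by blast
    from this[THEN arg_cong[of _ _ real]]
    have "1 + real (ell T (coord_class c)) - real (ell_at T (coord_class c) v)
        = real (dual_ell_at T (coord_class c) v)" for c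
      unfolding of_nat_add of_nat_Suc by (simp add: algebra_simps)
    then show ?thesis
      by (simp add: vec_eq_iff record_triple_nth reflection_vector_nth dual_ell_at_def)
  qed
  have img: "(\<lambda>v. nverts T - 1 - v) ` {..<nverts T} = {..<nverts T}"
  proof (intro equalityI subsetI)
    fix v assume "v \<in> {..<nverts T}"
    then show "v \<in> (\<lambda>v. nverts T - 1 - v) ` {..<nverts T}"
      by (intro image_eqI[of _ _ "nverts T - 1 - v"]) auto
  qed auto
  have "Record (Dual T) = record_triple (Dual T) ` (\<lambda>v. nverts T - 1 - v) ` {..<nverts T}"
    unfolding Record_def nverts_Dual img ..
  also have "\<dots> = (\<lambda>v. record_triple (Dual T) (nverts T - 1 - v)) ` {..<nverts T}"
    by (rule image_image)
  also have "\<dots> = (\<lambda>s. reflection_vector T - s) ` Record T"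
    using refl by (auto simp: Record_def image_image)
  finally show ?thesis by simp
qed

lemma reduced_realizationD:
  assumes "tournament T" "reduced_realization T S"
  shows "S = Record T" "canonical T"
proof -
  let ?S' = "(\<lambda>s. reflection_vector T - s) ` S"
  have S1: "ordered S" using assms(2) unfolding reduced_realization_def by (elim conjE)
  have S2: "T = Color S" using assms(2) unfolding reduced_realization_def by (elim conjE)
  have S3: "reduced S" using assms(2) unfolding reduced_realization_def by (elim conjE)
  have S4: "reduced ?S'" using assms(2) unfolding reduced_realization_def by (elim conjE)
  show eq: "S = Record T" using reduced_eq_Record[OF S3] unfolding S2[symmetric] .
  have D: "Color ?S' = Dual T" using Color_reflection[OF S1] unfolding S2[symmetric] .
  have "Color (Record T) = T" using S2 unfolding eq by (rule sym)
  moreover have "Color (Record (Dual T)) = Dual T"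
    using arg_cong[OF reduced_eq_Record[OF S4], of Color] unfolding D by (rule sym)
  ultimately show "canonical T"
    by (simp add: canonical_def Dual_Dual[OF assms(1)])
qed

lemma canonical_reduced_realization:
  assumes T: "tournament T" and "canonical T"
  shows "reduced_realization T (Record T)"
  unfolding reduced_realization_def Record_reflection[OF assms]
  using assms(2) reduced_Record[OF T] reduced_Record[OF tournament_Dual[OF T]] ordered_Record[OF T]
  by (simp add: canonical_def)

section \<open>The equivalence\<close>

theorem theoremC1:
  fixes T :: rgbk
  assumes "tournament T"
  shows
    "(canonical T \<longleftrightarrow>
        geometric T \<and> (\<forall>C\<in>{RGK, RBK, GBK}. stratification_condition T C)) \<and>
     (canonical T \<longleftrightarrow> (\<exists>S. reduced_realization T S)) \<and>
     (canonical T \<or>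
      (geometric T \<and> (\<forall>C\<in>{RGK, RBK, GBK}. stratification_condition T C)) \<or>
      (\<exists>S. reduced_realization T S) \<longrightarrow>
        (\<forall>S. reduced_realization T S \<longleftrightarrow> S = Record T))"
proof -
  have "canonical T \<longleftrightarrow> (\<forall>C\<in>{RGK, RBK, GBK}. stratification_condition T C)"
    unfolding ball_coord_class canonical_iff[OF assms] stratification_condition_iff[OF assms] ..
  moreover have "geometric T" if "canonical T"
  proof -
    have "T = Color (Record T)" using that unfolding canonical_def by (elim conjE) (rule sym)
    with ordered_Record[OF assms] show ?thesis unfolding geometric_def by blast
  qed
  ultimately show ?thesis
    using reduced_realizationD[OF assms] canonical_reduced_realization[OF assms] by blast
qed

end
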